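(* Let $\vdash$ be either classical or intuitionistic propositional derivability. For every formula $A$ that is ${\sf par}$-projective, its projection (the $E\in\mathcal{L}({\sf par})$ for which $A$ is $E$-projective) is provably equivalent to the uniform post-interpolant of $A$ with respect to ${\sf par}$.
   Context: The language $\mathcal{L}$ is built from atoms ${\sf var}\cup{\sf par}$ (variables and parameters, disjoint infinite sets) using $\bot,\wedge,\vee,\to$. $\mathcal{L}({\sf par})$ is the set of formulas whose atoms are all parameters. A substitution is a map $\theta:\mathcal{L}\to\mathcal{L}$ commuting with connectives with $\theta(p)=p$ for all $p\in{\sf par}$. $\theta$ is an $A$-identity if $A\vdash\theta(a)\leftrightarrow a$ for every atom $a$. For $E\in\mathcal{L}({\sf par})$, $A$ is $E$-projective if there is an $A$-identity $\theta$ with $\vdash\theta(A)\leftrightarrow E$; $A$ is ${\sf par}$-projective if it is $E$-projective for some $E\in\mathcal{L}({\sf par})$. The uniform post-interpolant of $A$ w.r.t. ${\sf par}$ is a formula $B\in\mathcal{L}({\sf par})$ with $\vdash A\to B$ such that $\vdash B\to C$ for every $C\in\mathcal{L}({\sf par})$ with $\vdash A\to C$. *)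

theory Defs
  imports Main
begin

datatype ('v, 'p) atom = Var 'v | Par 'p

datatype (atoms: 'a) form =
    Atom 'a
  | Bot ("\<^bold>\<bottom>")
  | Conj "'a form" "'a form" (infixr "\<^bold>\<and>" 65)
  | Disj "'a form" "'a form" (infixr "\<^bold>\<or>" 60)
  | Impl "'a form" "'a form" (infixr "\<^bold>\<rightarrow>" 55)

abbreviation Iff :: "'a form \<Rightarrow> 'a form \<Rightarrow> 'a form" (infix "\<^bold>\<leftrightarrow>" 54) where
  "A \<^bold>\<leftrightarrow> B \<equiv> (A \<^bold>\<rightarrow> B) \<^bold>\<and> (B \<^bold>\<rightarrow> A)"

type_synonym ('v, 'p) pform = "('v, 'p) atom form"

definition par_forms :: "('v, 'p) pform set" where
  "par_forms = {A. atoms A \<subseteq> range Par}"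

datatype calculus = Classical | Intuitionistic

text \<open>Natural deduction. Intuitionistic derivability is given by all rules except
  \<open>RAA\<close> (reductio ad absurdum), whose addition gives classical derivability.\<close>

inductive derives :: "'a form set \<Rightarrow> calculus \<Rightarrow> 'a form \<Rightarrow> bool"
  ("_ \<turnstile>\<^bsub>_\<^esub> _" [51, 0, 51] 50) where
  Assm: "A \<in> \<Gamma> \<Longrightarrow> \<Gamma> \<turnstile>\<^bsub>L\<^esub> A"
| BotE: "\<Gamma> \<turnstile>\<^bsub>L\<^esub> \<^bold>\<bottom> \<Longrightarrow> \<Gamma> \<turnstile>\<^bsub>L\<^esub> A"
| ConjI: "\<Gamma> \<turnstile>\<^bsub>L\<^esub> A \<Longrightarrow> \<Gamma> \<turnstile>\<^bsub>L\<^esub> B \<Longrightarrow> \<Gamma> \<turnstile>\<^bsub>L\<^esub> A \<^bold>\<and> B"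
| ConjE1: "\<Gamma> \<turnstile>\<^bsub>L\<^esub> A \<^bold>\<and> B \<Longrightarrow> \<Gamma> \<turnstile>\<^bsub>L\<^esub> A"
| ConjE2: "\<Gamma> \<turnstile>\<^bsub>L\<^esub> A \<^bold>\<and> B \<Longrightarrow> \<Gamma> \<turnstile>\<^bsub>L\<^esub> B"
| DisjI1: "\<Gamma> \<turnstile>\<^bsub>L\<^esub> A \<Longrightarrow> \<Gamma> \<turnstile>\<^bsub>L\<^esub> A \<^bold>\<or> B"
| DisjI2: "\<Gamma> \<turnstile>\<^bsub>L\<^esub> B \<Longrightarrow> \<Gamma> \<turnstile>\<^bsub>L\<^esub> A \<^bold>\<or> B"
| DisjE: "\<Gamma> \<turnstile>\<^bsub>L\<^esub> A \<^bold>\<or> B \<Longrightarrow> insert A \<Gamma> \<turnstile>\<^bsub>L\<^esub> C \<Longrightarrow> insert B \<Gamma> \<turnstile>\<^bsub>L\<^esub> C \<Longrightarrow> \<Gamma> \<turnstile>\<^bsub>L\<^esub> C"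
| ImplI: "insert A \<Gamma> \<turnstile>\<^bsub>L\<^esub> B \<Longrightarrow> \<Gamma> \<turnstile>\<^bsub>L\<^esub> A \<^bold>\<rightarrow> B"
| ImplE: "\<Gamma> \<turnstile>\<^bsub>L\<^esub> A \<^bold>\<rightarrow> B \<Longrightarrow> \<Gamma> \<turnstile>\<^bsub>L\<^esub> A \<Longrightarrow> \<Gamma> \<turnstile>\<^bsub>L\<^esub> B"
| RAA: "insert (A \<^bold>\<rightarrow> \<^bold>\<bottom>) \<Gamma> \<turnstile>\<^bsub>Classical\<^esub> \<^bold>\<bottom> \<Longrightarrow> \<Gamma> \<turnstile>\<^bsub>Classical\<^esub> A"

definition substitution :: "(('v, 'p) pform \<Rightarrow> ('v, 'p) pform) \<Rightarrow> bool" where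
  "substitution \<theta> \<longleftrightarrow>
     \<theta> \<^bold>\<bottom> = \<^bold>\<bottom> \<and>
     (\<forall>A B. \<theta> (A \<^bold>\<and> B) = \<theta> A \<^bold>\<and> \<theta> B) \<and>
     (\<forall>A B. \<theta> (A \<^bold>\<or> B) = \<theta> A \<^bold>\<or> \<theta> B) \<and>
     (\<forall>A B. \<theta> (A \<^bold>\<rightarrow> B) = \<theta> A \<^bold>\<rightarrow> \<theta> B) \<and>
     (\<forall>p. \<theta> (Atom (Par p)) = Atom (Par p))"

definition identity_for ::
    "calculus \<Rightarrow> ('v, 'p) pform \<Rightarrow> (('v, 'p) pform \<Rightarrow> ('v, 'p) pform) \<Rightarrow> bool" where
  "identity_for L A \<theta> \<longleftrightarrow> (\<forall>a. {A} \<turnstile>\<^bsub>L\<^esub> \<theta> (Atom a) \<^bold>\<leftrightarrow> Atom a)"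

definition projective :: "calculus \<Rightarrow> ('v, 'p) pform \<Rightarrow> ('v, 'p) pform \<Rightarrow> bool" where
  "projective L E A \<longleftrightarrow>
     (\<exists>\<theta>. substitution \<theta> \<and> identity_for L A \<theta> \<and> {} \<turnstile>\<^bsub>L\<^esub> \<theta> A \<^bold>\<leftrightarrow> E)"

definition par_projective :: "calculus \<Rightarrow> ('v, 'p) pform \<Rightarrow> bool" where
  "par_projective L A \<longleftrightarrow> (\<exists>E \<in> par_forms. projective L E A)"

definition uniform_post_interpolant ::
    "calculus \<Rightarrow> ('v, 'p) pform \<Rightarrow> ('v, 'p) pform \<Rightarrow> bool" where
  "uniform_post_interpolant L A B \<longleftrightarrow>
     B \<in> par_forms \<and> {} \<turnstile>\<^bsub>L\<^esub> A \<^bold>\<rightarrow> B \<and>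
     (\<forall>C \<in> par_forms. {} \<turnstile>\<^bsub>L\<^esub> A \<^bold>\<rightarrow> C \<longrightarrow> {} \<turnstile>\<^bsub>L\<^esub> B \<^bold>\<rightarrow> C)"

end

theory Submission
  imports Defs
begin

text \<open>If \<open>\<theta>\<close> is an \<open>A\<close>-identity, then \<open>A\<close> proves \<open>\<theta>(A) \<leftrightarrow> A\<close>, hence \<open>\<theta>(A)\<close>, hence \<open>E\<close>.
  Conversely, if \<open>A \<rightarrow> C\<close> is derivable with \<open>C\<close> over the parameters, applying \<open>\<theta>\<close> gives
  \<open>\<theta>(A) \<rightarrow> C\<close>, that is, \<open>E \<rightarrow> C\<close>. So \<open>E\<close> is a uniform post-interpolant, and those are
  unique up to provable equivalence.\<close>

text \<open>\<open>DisjE\<close>, \<open>ImplI\<close> and \<open>RAA\<close> discharge an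
  assumption, so their induction hypotheses are applied to \<Delta> enlarged by that assumption.
  This is why \<Delta> is generalized.\<close>

lemma derives_mono:
  assumes "\<Gamma> \<turnstile>\<^bsub>L\<^esub> A" and "\<Gamma> \<subseteq> \<Delta>"
  shows "\<Delta> \<turnstile>\<^bsub>L\<^esub> A"
  using assms
proof (induction arbitrary: \<Delta> rule: derives.induct)
  case (DisjE \<Gamma> L A B C)
  then show ?case by (meson derives.DisjE insert_mono)
next
  case (ImplI A \<Gamma> L B)
  then show ?case by (meson derives.ImplI insert_mono)
next
  case (RAA A \<Gamma>)
  then show ?case by (meson derives.RAA insert_mono)
qed (blast intro: derives.intros)+

lemma derives_insert: "\<Gamma> \<turnstile>\<^bsub>L\<^esub> A \<Longrightarrow> insert B \<Gamma> \<turnstile>\<^bsub>L\<^esub> A"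
  by (erule derives_mono) blast

lemma derives_Impl_iff: "\<Gamma> \<turnstile>\<^bsub>L\<^esub> A \<^bold>\<rightarrow> B \<longleftrightarrow> insert A \<Gamma> \<turnstile>\<^bsub>L\<^esub> B"
proof
  assume "\<Gamma> \<turnstile>\<^bsub>L\<^esub> A \<^bold>\<rightarrow> B"
  then have "insert A \<Gamma> \<turnstile>\<^bsub>L\<^esub> A \<^bold>\<rightarrow> B" by (rule derives_insert)
  then show "insert A \<Gamma> \<turnstile>\<^bsub>L\<^esub> B" by (rule ImplE) (simp add: Assm)
qed (rule ImplI)

lemma derives_Conj_iff: "\<Gamma> \<turnstile>\<^bsub>L\<^esub> A \<^bold>\<and> B \<longleftrightarrow> \<Gamma> \<turnstile>\<^bsub>L\<^esub> A \<and> \<Gamma> \<turnstile>\<^bsub>L\<^esub> B"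
  by (blast intro: ConjI ConjE1 ConjE2)

lemma derives_Impl_refl: "\<Gamma> \<turnstile>\<^bsub>L\<^esub> A \<^bold>\<rightarrow> A"
  by (simp add: ImplI Assm)

lemma derives_Impl_trans:
  assumes "\<Gamma> \<turnstile>\<^bsub>L\<^esub> A \<^bold>\<rightarrow> B" and "\<Gamma> \<turnstile>\<^bsub>L\<^esub> B \<^bold>\<rightarrow> C"
  shows "\<Gamma> \<turnstile>\<^bsub>L\<^esub> A \<^bold>\<rightarrow> C"
  using assms by (meson ImplE ImplI derives_Impl_iff derives_insert)

text \<open>This and the next two monotonicity lemmas, each used in both directions, make provable
  equivalence under a fixed context a congruence for the connectives.\<close>

lemma derives_Conj_mono:
  assumes "\<Gamma> \<turnstile>\<^bsub>L\<^esub> A \<^bold>\<rightarrow> A'" and "\<Gamma> \<turnstile>\<^bsub>L\<^esub> B \<^bold>\<rightarrow> B'"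
  shows "\<Gamma> \<turnstile>\<^bsub>L\<^esub> A \<^bold>\<and> B \<^bold>\<rightarrow> A' \<^bold>\<and> B'"
proof (rule ImplI)
  have "insert (A \<^bold>\<and> B) \<Gamma> \<turnstile>\<^bsub>L\<^esub> A \<^bold>\<and> B" by (simp add: Assm)
  then show "insert (A \<^bold>\<and> B) \<Gamma> \<turnstile>\<^bsub>L\<^esub> A' \<^bold>\<and> B'"
    using assms by (meson ConjI ConjE1 ConjE2 ImplE derives_insert)
qed

lemma derives_Disj_mono:
  assumes "\<Gamma> \<turnstile>\<^bsub>L\<^esub> A \<^bold>\<rightarrow> A'" and "\<Gamma> \<turnstile>\<^bsub>L\<^esub> B \<^bold>\<rightarrow> B'"
  shows "\<Gamma> \<turnstile>\<^bsub>L\<^esub> A \<^bold>\<or> B \<^bold>\<rightarrow> A' \<^bold>\<or> B'"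
proof (rule ImplI, rule DisjE)
  show "insert (A \<^bold>\<or> B) \<Gamma> \<turnstile>\<^bsub>L\<^esub> A \<^bold>\<or> B" by (simp add: Assm)
  show "insert A (insert (A \<^bold>\<or> B) \<Gamma>) \<turnstile>\<^bsub>L\<^esub> A' \<^bold>\<or> B'"
    using assms by (meson DisjI1 derives_Impl_iff derives_insert)
  show "insert B (insert (A \<^bold>\<or> B) \<Gamma>) \<turnstile>\<^bsub>L\<^esub> A' \<^bold>\<or> B'"
    using assms by (meson DisjI2 derives_Impl_iff derives_insert)
qed

lemma derives_Impl_mono:
  assumes "\<Gamma> \<turnstile>\<^bsub>L\<^esub> A' \<^bold>\<rightarrow> A" and "\<Gamma> \<turnstile>\<^bsub>L\<^esub> B \<^bold>\<rightarrow> B'"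
  shows "\<Gamma> \<turnstile>\<^bsub>L\<^esub> (A \<^bold>\<rightarrow> B) \<^bold>\<rightarrow> (A' \<^bold>\<rightarrow> B')"
proof (rule ImplI)
  have "insert (A \<^bold>\<rightarrow> B) \<Gamma> \<turnstile>\<^bsub>L\<^esub> A \<^bold>\<rightarrow> B" by (simp add: Assm)
  then show "insert (A \<^bold>\<rightarrow> B) \<Gamma> \<turnstile>\<^bsub>L\<^esub> A' \<^bold>\<rightarrow> B'"
    using assms by (meson derives_Impl_trans derives_insert)
qed

lemma substitution_simps:
  assumes "substitution \<theta>"
  shows "\<theta> \<^bold>\<bottom> = \<^bold>\<bottom>" "\<theta> (A \<^bold>\<and> B) = \<theta> A \<^bold>\<and> \<theta> B" "\<theta> (A \<^bold>\<or> B) = \<theta> A \<^bold>\<or> \<theta> B"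
    "\<theta> (A \<^bold>\<rightarrow> B) = \<theta> A \<^bold>\<rightarrow> \<theta> B" "\<theta> (Atom (Par p)) = Atom (Par p)"
  using assms by (auto simp: substitution_def)

text \<open>The rules are schematic and \<theta> commutes with the connectives, so each rule
  instance is mapped to an instance of the same rule. In \<open>BotE\<close> and \<open>RAA\<close>
  this relies on \<theta> fixing \<open>Bot\<close>.\<close>

lemma derives_substitution:
  assumes "\<Gamma> \<turnstile>\<^bsub>L\<^esub> A" and "substitution \<theta>"
  shows "\<theta> ` \<Gamma> \<turnstile>\<^bsub>L\<^esub> \<theta> A"
  using assms(1)
  by induction
    (auto simp: substitution_simps[OF assms(2)] intro: derives.intros)

lemma substitution_par_forms:
  assumes "substitution \<theta>" and "C \<in> par_forms"
  shows "\<theta> C = C"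
proof -
  have "atoms C \<subseteq> range Par \<Longrightarrow> \<theta> C = C"
    by (induction C) (auto simp: substitution_simps[OF assms(1)])
  then show ?thesis using assms(2) by (simp add: par_forms_def)
qed

text \<open>The defining condition speaks of atoms only. Since equivalence under the assumption
  \<open>A\<close> is a congruence, induction on \<open>B\<close> extends it to all formulas, in
  particular to \<open>A\<close> itself.\<close>

lemma identity_for_form:
  assumes "substitution \<theta>" and "identity_for L A \<theta>"
  shows "{A} \<turnstile>\<^bsub>L\<^esub> \<theta> B \<^bold>\<leftrightarrow> B"
proof (induction B)
  case (Atom a)
  then show ?case using assms(2) by (simp add: identity_for_def)
qed (simp_all add: substitution_simps[OF assms(1)] derives_Conj_iff derives_Impl_refl
      derives_Conj_mono derives_Disj_mono derives_Impl_mono)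

lemma projective_imp_uniform_post_interpolant:
  assumes "E \<in> par_forms" and "projective L E A"
  shows "uniform_post_interpolant L A E"
proof -
  obtain \<theta> where \<theta>: "substitution \<theta>" "identity_for L A \<theta>"
    and E: "{} \<turnstile>\<^bsub>L\<^esub> \<theta> A \<^bold>\<rightarrow> E" "{} \<turnstile>\<^bsub>L\<^esub> E \<^bold>\<rightarrow> \<theta> A"
    using assms(2) by (auto simp: projective_def derives_Conj_iff)
  have "{A} \<turnstile>\<^bsub>L\<^esub> A \<^bold>\<rightarrow> \<theta> A"
    using identity_for_form[OF \<theta>] by (simp add: derives_Conj_iff)
  \<comment> \<open>Moving the antecedent into the context turns both this claim and the previous
    fact into derivability of \<open>\<theta> A\<close> from \<open>{A}\<close>, because inserting
    \<open>A\<close> into \<open>{A}\<close> changes nothing.\<close>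
  then have "{} \<turnstile>\<^bsub>L\<^esub> A \<^bold>\<rightarrow> \<theta> A" by (simp add: derives_Impl_iff)
  then have "{} \<turnstile>\<^bsub>L\<^esub> A \<^bold>\<rightarrow> E" using E(1) by (rule derives_Impl_trans)
  moreover have "{} \<turnstile>\<^bsub>L\<^esub> E \<^bold>\<rightarrow> C" if "C \<in> par_forms" "{} \<turnstile>\<^bsub>L\<^esub> A \<^bold>\<rightarrow> C" for C
  proof -
    \<comment> \<open>The context stays empty under \<theta>, and \<open>C\<close> is left unchanged
      because it contains only parameters.\<close>
    have "{} \<turnstile>\<^bsub>L\<^esub> \<theta> A \<^bold>\<rightarrow> C"
      using derives_substitution[OF that(2) \<theta>(1)]
      by (simp add: substitution_simps[OF \<theta>(1)] substitution_par_forms[OF \<theta>(1) that(1)])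
    with E(2) show ?thesis by (rule derives_Impl_trans)
  qed
  ultimately show ?thesis using assms(1) by (simp add: uniform_post_interpolant_def)
qed

text \<open>Each of \<open>B\<close> and \<open>B'\<close> is a parameter formula implied by
  \<open>A\<close>, so each can serve as the \<open>C\<close> in the minimality condition of the
  other.\<close>

lemma uniform_post_interpolant_unique:
  assumes "uniform_post_interpolant L A B" and "uniform_post_interpolant L A B'"
  shows "{} \<turnstile>\<^bsub>L\<^esub> B \<^bold>\<leftrightarrow> B'"
  using assms by (simp add: uniform_post_interpolant_def derives_Conj_iff)

theorem theorem2p2:
  fixes L :: calculus and A :: "('v, 'p) pform"
  assumes "infinite (UNIV :: 'v set)" and "infinite (UNIV :: 'p set)"
    and "par_projective L A"
  shows "(\<exists>B. uniform_post_interpolant L A B) \<and>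
    (\<forall>E \<in> par_forms. projective L E A \<longrightarrow>
      (\<forall>B. uniform_post_interpolant L A B \<longrightarrow> {} \<turnstile>\<^bsub>L\<^esub> E \<^bold>\<leftrightarrow> B))"
  \<comment> \<open>The projection supplied by \<open>par_projective\<close> is the witness for
    existence; the second conjunct compares an arbitrary projection with an arbitrary interpolant by
    uniqueness.\<close>
  using assms(3) projective_imp_uniform_post_interpolant uniform_post_interpolant_unique
  unfolding par_projective_def by blast

end
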